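(* Let $(X,d)$ be a metric space. Then $d$ is an ultrametric (i.e. $d(x,z)\le \max\{d(x,y),d(y,z)\}$ for all $x,y,z\in X$) if and only if, for every discrete measure $\mu$ on $X$ with nonempty support and such that every closed ball has finite $\mu$-measure, the centered and non-centered Hardy–Littlewood maximal operators coincide, that is, $M^c_\mu f(x)=M_\mu f(x)$ for every locally $\mu$-integrable $f$ and every $x\in\operatorname{supp}(\mu)$.
   Context: Measures are positive Borel measures on $X$. A discrete measure is a (countable) weighted sum of Dirac measures, $\mu=\sum_i c_i\delta_{x_i}$ with $c_i>0$, $x_i\in X$. $\operatorname{supp}(\mu)$ is the set of points all of whose open neighbourhoods have positive $\mu$-measure. A ball means a closed ball $B(x,r)=\{y\in X: d(x,y)\le r\}$ with $r>0$. For a locally $\mu$-integrable function $f$ (integrable on every ball) and $x\in\operatorname{supp}(\mu)$, define $$M^c_\mu f(x)=\sup_{r>0}\frac{1}{\mu(B(x,r))}\int_{B(x,r)} f\,d\mu,\qquad M_\mu f(x)=\sup_{B:\,B\ni x}\frac{1}{\mu(B)}\int_B f\,d\mu,$$ where the second supremum is over all balls $B$ containing $x$, and the average $\frac1{\mu(B)}\int_B f\,d\mu$ is taken to be $0$ if $\mu(B)=0$. *)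

theory Defs
  imports "HOL-Probability.Giry_Monad"
begin

text \<open>
  A countable weighted sum of Dirac measures with weights in \<open>(0,\<infinity>)\<close>. The index set \<open>I\<close> ranges
  over all sets of naturals, so finite sums and the zero measure are included; \<open>return borel x\<close>
  is the Dirac measure at \<open>x\<close>.
\<close>

definition discrete_measure :: "'a::metric_space measure \<Rightarrow> bool" where
  "discrete_measure M \<longleftrightarrow> sets M = sets borel \<and>
     (\<exists>(I :: nat set) (c :: nat \<Rightarrow> real) (x :: nat \<Rightarrow> 'a). (\<forall>i\<in>I. 0 < c i) \<and>
        (\<forall>A\<in>sets borel.
           emeasure M A = (\<Sum>\<^sub>\<infinity>i\<in>I. ennreal (c i) * emeasure (return borel (x i)) A)))"

definition measure_supp :: "'a::metric_space measure \<Rightarrow> 'a set" where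
  "measure_supp M = {x. \<forall>U. open U \<longrightarrow> x \<in> U \<longrightarrow> 0 < emeasure M U}"

definition locally_integrable :: "'a::metric_space measure \<Rightarrow> ('a \<Rightarrow> real) \<Rightarrow> bool" where
  "locally_integrable M f \<longleftrightarrow> (\<forall>x r. 0 < r \<longrightarrow> set_integrable M (cball x r) f)"

definition avg :: "'a::metric_space measure \<Rightarrow> ('a \<Rightarrow> real) \<Rightarrow> 'a set \<Rightarrow> real" where
  "avg M f B = (if emeasure M B = 0 then 0 else (LINT y:B|M. f y) / measure M B)"

text \<open>
  The suprema are taken in \<^typ>\<open>ereal\<close> because they may be infinite. As \<open>f\<close> itself rather than
  its absolute value is averaged, they may also be negative.
\<close>

definition centered_maximal :: "'a::metric_space measure \<Rightarrow> ('a \<Rightarrow> real) \<Rightarrow> 'a \<Rightarrow> ereal" where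
  "centered_maximal M f x = (SUP r\<in>{0<..}. ereal (avg M f (cball x r)))"

definition noncentered_maximal :: "'a::metric_space measure \<Rightarrow> ('a \<Rightarrow> real) \<Rightarrow> 'a \<Rightarrow> ereal" where
  "noncentered_maximal M f x =
     (SUP B\<in>{B. (\<exists>y r. 0 < r \<and> B = cball y r) \<and> x \<in> B}. ereal (avg M f B))"

end

theory Submission
  imports Defs
begin

text \<open>
  In an ultrametric space every point of a closed ball is a centre of it, so both suprema range
  over the same balls. Conversely, if \<open>d\<close> is not an ultrametric, there are points with
  \<open>d(a,b) \<le> d(b,c) < d(a,c)\<close>. Let \<open>\<mu> = \<delta>\<^sub>a + \<delta>\<^sub>b + \<delta>\<^sub>c\<close> and let \<open>f\<close> be the indicator of \<open>{c}\<close>.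
  Every ball centred at \<open>b\<close> that contains \<open>c\<close> also contains \<open>a\<close>, so the centred maximal function
  at \<open>b\<close> is at most \<open>1/3\<close>, whereas the ball \<open>B(c, d(b,c))\<close> contains \<open>b\<close> and \<open>c\<close> but not \<open>a\<close> and
  has average \<open>1/2\<close>.
\<close>

text \<open>Both inclusions come from \<open>dist x y \<le> r\<close>: the inequality for
  \<open>x\<close>, \<open>y\<close>, \<open>w\<close> bounds \<open>dist x w\<close>, and the one
  for \<open>y\<close>, \<open>x\<close>, \<open>w\<close> bounds \<open>dist y w\<close>.\<close>

lemma ultrametric_cball_recenter:
  fixes x y :: "'a::metric_space"
  assumes um: "\<And>x y z :: 'a. dist x z \<le> max (dist x y) (dist y z)"
    and x: "x \<in> cball y r"
  shows "cball y r = cball x r"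
proof -
  have "dist x w \<le> r \<longleftrightarrow> dist y w \<le> r" for w
    using um[of x w y] um[of y w x] x by (auto simp: dist_commute)
  then show ?thesis by auto
qed

lemma ultrametric_maximal_eq:
  fixes M :: "'a::metric_space measure"
  assumes um: "\<And>x y z :: 'a. dist x z \<le> max (dist x y) (dist y z)"
  shows "centered_maximal M f x = noncentered_maximal M f x"
proof -
  have "{B. (\<exists>y r. 0 < r \<and> B = cball y r) \<and> x \<in> B} = cball x ` {0<..}"
    using ultrametric_cball_recenter[OF um] by fastforce
  then show ?thesis
    unfolding centered_maximal_def noncentered_maximal_def by (simp add: image_image)
qed

text \<open>For finite \<open>S\<close> this is the sum of the Dirac measures at the points of
  \<open>S\<close>. The push-forward along the identity moves the counting measure from the subsets
  of \<open>S\<close> to the Borel sets of the whole space.\<close>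

definition counting_borel :: "'a::metric_space set \<Rightarrow> 'a measure" where
  "counting_borel S = distr (count_space S) borel (\<lambda>x. x)"

lemma sets_counting_borel [simp, measurable_cong]: "sets (counting_borel S) = sets borel"
  by (simp add: counting_borel_def)

lemma space_counting_borel [simp]: "space (counting_borel S) = UNIV"
  by (simp add: counting_borel_def)

lemma emeasure_counting_borel:
  assumes "finite S" "A \<in> sets borel"
  shows "emeasure (counting_borel S) A = of_nat (card (S \<inter> A))"
  using assms by (simp add: counting_borel_def emeasure_distr Int_commute)

lemma finite_measure_counting_borel:
  assumes "finite S"
  shows "finite_measure (counting_borel S)"
  by (rule finite_measureI) (use assms in \<open>simp add: emeasure_counting_borel\<close>)

lemma discrete_measure_counting_borel:
  fixes S :: "'a::metric_space set"
  assumes "finite S"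
  shows "discrete_measure (counting_borel S)"
proof -
  obtain x where x: "bij_betw x {0..<card S} S"
    using ex_bij_betw_nat_finite[OF assms] by blast
  have "emeasure (counting_borel S) A =
      (\<Sum>\<^sub>\<infinity>i\<in>{0..<card S}. ennreal 1 * emeasure (return borel (x i)) A)"
    if A: "A \<in> sets borel" for A
  proof -
    have "(\<Sum>\<^sub>\<infinity>i\<in>{0..<card S}. ennreal 1 * emeasure (return borel (x i)) A)
        = (\<Sum>i\<in>{0..<card S}. indicator A (x i))"
      using A by simp
    also have "\<dots> = (\<Sum>y\<in>S. indicator A y)"
      by (rule sum.reindex_bij_betw[OF x])
    also have "\<dots> = of_nat (card (S \<inter> A))"
      using assms by (simp add: indicator_def sum.If_cases Int_def)
    finally show ?thesis
      using A assms by (simp add: emeasure_counting_borel)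
  qed
  then show ?thesis
    unfolding discrete_measure_def
    by (intro conjI exI[of _ "{0..<card S}"] exI[of _ "\<lambda>_. 1"] exI[of _ x]) auto
qed

lemma mem_measure_supp_counting_borel:
  assumes "finite S" "x \<in> S"
  shows "x \<in> measure_supp (counting_borel S)"
  using assms by (auto simp: measure_supp_def emeasure_counting_borel card_gt_0_iff)

lemma avg_counting_borel:
  assumes "finite S" "f \<in> borel_measurable borel" "B \<in> sets borel"
  shows "avg (counting_borel S) f B = (\<Sum>y\<in>S \<inter> B. f y) / card (S \<inter> B)"
proof -
  have "(LINT y:B|counting_borel S. f y) = (\<Sum>y\<in>S. indicator B y * f y)"
    unfolding set_lebesgue_integral_def counting_borel_def
    using assms by (subst integral_distr) (auto simp: lebesgue_integral_count_space_finite)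
  also have "\<dots> = (\<Sum>y\<in>S \<inter> B. f y)"
    using assms by (simp add: sum.inter_restrict indicator_def if_distrib cong: if_cong)
  \<comment> \<open>If \<open>S \<inter> B\<close> is empty, the default value 0 in
    \<open>avg\<close> agrees with \<open>0 / 0 = 0\<close>.\<close>
  finally show ?thesis
    using assms by (simp add: avg_def emeasure_counting_borel measure_def)
qed

lemma maximal_operators_differ:
  fixes a b c :: "'a::metric_space"
  assumes ac: "dist b c < dist a c" and ab: "dist a b \<le> dist b c" and "a \<noteq> b"
  defines "M \<equiv> counting_borel {a, b, c}"
  shows "centered_maximal M (indicator {c}) b < noncentered_maximal M (indicator {c}) b"
proof -
  \<comment> \<open>If \<open>b = c\<close>, then \<open>dist a b \<le> 0\<close>, contrary to
    \<open>a \<noteq> b\<close>; and \<open>dist a c\<close> is positive because it exceeds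
    \<open>dist b c\<close>. Hence the point counts are exactly 3 and 2, and \<open>dist b c\<close>
    is an admissible radius.\<close>
  have ne: "a \<noteq> b" "b \<noteq> c" "a \<noteq> c"
    using assms by auto
  have avg: "avg M (indicator {c}) (cball y r) =
      (if c \<in> cball y r then 1 / card ({a, b, c} \<inter> cball y r) else 0)" for y r
    unfolding M_def by (subst avg_counting_borel) (auto simp: indicator_def sum.If_cases)
  have "avg M (indicator {c}) (cball b r) \<le> 1 / 3" if "r > 0" for r
  proof (cases "c \<in> cball b r")
    case True
    then have "{a, b, c} \<inter> cball b r = {a, b, c}"
      using ab that by (auto simp: dist_commute)
    with True show ?thesis
      using ne by (simp add: avg del: mem_cball)
  qed (simp add: avg del: mem_cball)
  then have "centered_maximal M (indicator {c}) b \<le> ereal (1 / 3)"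
    unfolding centered_maximal_def by (intro SUP_least) simp
  also have "\<dots> < ereal (1 / 2)"
    by simp
  also have "{a, b, c} \<inter> cball c (dist b c) = {b, c}"
    using ac by (auto simp: dist_commute)
  then have "ereal (1 / 2) = ereal (avg M (indicator {c}) (cball c (dist b c)))"
    using ne by (simp add: avg)
  also have "\<dots> \<le> noncentered_maximal M (indicator {c}) b"
    unfolding noncentered_maximal_def
    using ne by (intro SUP_upper) (auto simp: dist_commute intro!: exI[of _ c] exI[of _ "dist b c"])
  finally show ?thesis .
qed

theorem theorem1p2:
  shows "(\<forall>x y z :: 'a::metric_space. dist x z \<le> max (dist x y) (dist y z)) \<longleftrightarrow>
    (\<forall>M :: 'a measure.
       discrete_measure M \<longrightarrow> measure_supp M \<noteq> {} \<longrightarrow>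
       (\<forall>x r. 0 < r \<longrightarrow> emeasure M (cball x r) < \<infinity>) \<longrightarrow>
       (\<forall>f :: 'a \<Rightarrow> real. locally_integrable M f \<longrightarrow>
          (\<forall>x\<in>measure_supp M. centered_maximal M f x = noncentered_maximal M f x)))"
  (is "?ultrametric \<longleftrightarrow> ?maximal")
proof
  assume ?ultrametric
  then show ?maximal
    using ultrametric_maximal_eq by blast
next
  assume max_eq: ?maximal
  have eq: "centered_maximal (counting_borel S) (indicator {c}) b =
      noncentered_maximal (counting_borel S) (indicator {c}) b"
    if S: "finite S" "b \<in> S" for S :: "'a set" and b c
  proof -
    interpret finite_measure "counting_borel S"
      using finite_measure_counting_borel[OF S(1)] .
    have "locally_integrable (counting_borel S) (indicator {c} :: 'a \<Rightarrow> real)"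
      unfolding locally_integrable_def set_integrable_def
    \<comment> \<open>The product of the two indicators is bounded by 1, and the measure is
      finite.\<close>
    proof (intro allI impI integrable_const_bound[where B = 1])
      show "(\<lambda>y. indicat_real (cball x r) y *\<^sub>R indicat_real {c} y)
          \<in> borel_measurable (counting_borel S)" for x r
        by (intro borel_measurable_scaleR borel_measurable_indicator) simp_all
    qed (auto simp: indicator_def)
    moreover have "b \<in> measure_supp (counting_borel S)"
      using S by (rule mem_measure_supp_counting_borel)
    moreover have "emeasure (counting_borel S) (cball x r) < \<infinity>" for x r
      by (simp add: less_top[symmetric])
    ultimately show ?thesis
      using max_eq discrete_measure_counting_borel[OF S(1)] by blast
  qed
  show ?ultrametric
  proof (rule ccontr)
    assume "\<not> ?ultrametric"
    then obtain x y z :: 'a where xyz: "dist x y < dist x z" "dist y z < dist x z"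
      by (auto simp: not_le)
    then have "x \<noteq> y" "z \<noteq> y"
      by auto
    \<comment> \<open>The middle point \<open>y\<close> becomes \<open>b\<close>, and the endpoint
      nearer to \<open>y\<close> becomes \<open>a\<close>: the triple is \<open>x\<close>,
      \<open>y\<close>, \<open>z\<close> or its reversal \<open>z\<close>, \<open>y\<close>,
      \<open>x\<close>.\<close>
    have "\<exists>a b c :: 'a. dist b c < dist a c \<and> dist a b \<le> dist b c \<and> a \<noteq> b"
    proof (cases "dist x y \<le> dist y z")
      case True
      with xyz \<open>x \<noteq> y\<close> show ?thesis by blast
    next
      case False
      then have "dist y x < dist z x \<and> dist z y \<le> dist y x \<and> z \<noteq> y"
        using xyz \<open>z \<noteq> y\<close> by (simp add: dist_commute)
      then show ?thesis by blast
    qed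
    then obtain a b c :: 'a where "dist b c < dist a c" "dist a b \<le> dist b c" "a \<noteq> b"
      by blast
    from maximal_operators_differ[OF this] eq[of "{a, b, c}" b c] show False
      by simp
  qed
qed

end
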